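(* Let $X,Y$ be complex Banach spaces, let $T:X\to Y$ be a non-null bounded linear operator, and let $\lambda$ be a real number with $\|T\|\le\lambda$. Let $n\ge 1$ and $1\le p\le\infty$ (with $1/p=0$ if $p=\infty$). Put $$\rho=\frac{\lambda-\|T\|}{2\lambda-\|T\|},\qquad \sigma_1=\frac{\lambda-\|T\|}{(\lambda-\|T\|+1)\|T\|},\qquad \sigma_2=\frac{\lambda-\|T\|}{\lambda-\|T\|+1},$$ and $$C=\begin{cases}\max(\rho,\sigma_1), & \text{if } \|T\|\ge 1,\\ \max(\rho,\sigma_2), & \text{if } 0<\|T\|<1.\end{cases}$$ Then $$B(B_p^n,T,\lambda)\ \ge\ \frac{C}{n^{1+1/p}}.$$
   Context: For $1\le p\le\infty$, $B_p^n=\{z\in\mathbb{C}^n:\|z\|_p<1\}$, where $\|\cdot\|_p$ is the usual $\ell_p$-norm on $\mathbb{C}^n$ (so $B_\infty^n=\mathbb{D}^n$ is the unit polydisk). A domain $\Omega\subseteq\mathbb{C}^n$ is complete Reinhardt if $(z_1,\dots,z_n)\in\Omega$ and $|\lambda_k|\le 1$ for all $k$ imply $(\lambda_1z_1,\dots,\lambda_nz_n)\in\Omega$. Multi-indices: $\alpha\in\mathbb{N}_0^n$, $z^\alpha=z_1^{\alpha_1}\cdots z_n^{\alpha_n}$. For $r\ge 0$, $r\cdot\Omega=\{rz:z\in\Omega\}$. Definition ($\lambda$-second Bohr radius). Let $\Omega\subset\mathbb{C}^n$ be a bounded complete Reinhardt domain and $T:X\to Y$ a non-null bounded linear operator between complex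 Banach spaces with $\|T\|\le\lambda$. $B(\Omega,T,\lambda)$ is the largest $r\ge 0$ such that $$\sum_{\alpha\in\mathbb{N}_0^n}\ \sup_{z\in r\cdot\Omega}\|T(a_\alpha)z^\alpha\|_Y\ \le\ \lambda\sup_{z\in\Omega}\|f(z)\|_X$$ for every (bounded) holomorphic $f:\Omega\to X$ with power series expansion $f(z)=\sum_{\alpha\in\mathbb{N}_0^n}a_\alpha z^\alpha$, $a_\alpha\in X$. *)

theory Defs
  imports "HOL-Analysis.Analysis"
begin

text \<open>The real structure of a complex normed space is kept as its \<open>real_normed_vector\<close> structure,
  so that the library's topology, \<open>has_derivative\<close>, \<open>has_sum\<close> and \<open>onorm\<close> apply.\<close>

class complex_normed_vector = real_normed_vector +
  fixes scaleC :: "complex \<Rightarrow> 'a \<Rightarrow> 'a"  (infixr \<open>*\<^sub>C\<close> 75)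
  assumes scaleC_add_right: "c *\<^sub>C (x + y) = c *\<^sub>C x + c *\<^sub>C y"
    and scaleC_add_left: "(c + d) *\<^sub>C x = c *\<^sub>C x + d *\<^sub>C x"
    and scaleC_scaleC: "c *\<^sub>C d *\<^sub>C x = (c * d) *\<^sub>C x"
    and scaleC_complex_of_real: "complex_of_real r *\<^sub>C x = r *\<^sub>R x"
    and norm_scaleC: "norm (c *\<^sub>C x) = cmod c * norm x"

class complex_banach = complex_normed_vector + banach

instantiation complex :: complex_banach
begin

definition scaleC_complex :: "complex \<Rightarrow> complex \<Rightarrow> complex" where
  "scaleC_complex c x = c * x"

instance
  by standard (auto simp: scaleC_complex_def algebra_simps norm_mult scaleR_conv_of_real)

end

text \<open>For such \<open>T\<close>, the operator norm is the library's \<open>onorm T\<close>.\<close>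

definition bounded_clinear :: "('x::complex_normed_vector \<Rightarrow> 'y::complex_normed_vector) \<Rightarrow> bool" where
  "bounded_clinear T \<longleftrightarrow> bounded_linear T \<and> (\<forall>c x. T (c *\<^sub>C x) = c *\<^sub>C T x)"

text \<open>The space \<open>\<complex>\<^sup>n\<close> is \<open>complex ^ 'n\<close>, and multi-indices are functions \<open>'n \<Rightarrow> nat\<close>.\<close>

definition monomial :: "complex ^ 'n \<Rightarrow> ('n::finite \<Rightarrow> nat) \<Rightarrow> complex" where
  "monomial z \<alpha> = (\<Prod>i\<in>UNIV. (z $ i) ^ \<alpha> i)"

definition lp_norm :: "ereal \<Rightarrow> complex ^ 'n::finite \<Rightarrow> real" where
  "lp_norm p z =
     (if p = \<infinity> then Max (range (\<lambda>i. cmod (z $ i)))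
      else (\<Sum>i\<in>UNIV. cmod (z $ i) powr real_of_ereal p) powr (1 / real_of_ereal p))"

definition lp_ball :: "ereal \<Rightarrow> (complex ^ 'n::finite) set" where
  "lp_ball p = {z. lp_norm p z < 1}"

text \<open>Holomorphy on an open set: the Frechet derivative exists at every point and is
  complex-linear.\<close>

definition holomorphic_vec_on ::
    "(complex ^ 'n::finite \<Rightarrow> 'x::complex_normed_vector) \<Rightarrow> (complex ^ 'n) set \<Rightarrow> bool" where
  "holomorphic_vec_on f \<Omega> \<longleftrightarrow>
     (\<forall>z\<in>\<Omega>. \<exists>D. (f has_derivative D) (at z) \<and> (\<forall>c v. D (c *s v) = c *\<^sub>C D v))"

definition has_power_series_on ::
    "(complex ^ 'n::finite \<Rightarrow> 'x::complex_normed_vector) \<Rightarrow> (('n \<Rightarrow> nat) \<Rightarrow> 'x)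
       \<Rightarrow> (complex ^ 'n) set \<Rightarrow> bool" where
  "has_power_series_on f a \<Omega> \<longleftrightarrow>
     (\<forall>z\<in>\<Omega>. ((\<lambda>\<alpha>. monomial z \<alpha> *\<^sub>C a \<alpha>) has_sum f z) UNIV)"

text \<open>The suprema and the series are taken in \<open>[0, \<infinity>]\<close>, so a divergent series violates the
  inequality, while for \<open>\<lambda> > 0\<close> an unbounded \<open>f\<close> satisfies it trivially; hence only bounded \<open>f\<close>
  matter. The notion is meant for bounded complete Reinhardt domains \<open>\<Omega>\<close>.\<close>

definition second_bohr_ineq ::
    "(complex ^ 'n::finite) set \<Rightarrow> ('x::complex_banach \<Rightarrow> 'y::complex_banach) \<Rightarrow> real \<Rightarrow> real \<Rightarrow> bool"
  where
  "second_bohr_ineq \<Omega> T lam r \<longleftrightarrow>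
     (\<forall>f a. holomorphic_vec_on f \<Omega> \<longrightarrow> has_power_series_on f a \<Omega> \<longrightarrow>
        (\<Sum>\<^sub>\<infinity>\<alpha>. SUP z\<in>(\<lambda>z. r *\<^sub>R z) ` \<Omega>. ennreal (norm (monomial z \<alpha> *\<^sub>C T (a \<alpha>))))
          \<le> ennreal lam * (SUP z\<in>\<Omega>. ennreal (norm (f z))))"

definition second_bohr_radius ::
    "(complex ^ 'n::finite) set \<Rightarrow> ('x::complex_banach \<Rightarrow> 'y::complex_banach) \<Rightarrow> real \<Rightarrow> real" where
  "second_bohr_radius \<Omega> T lam = (GREATEST r. 0 \<le> r \<and> second_bohr_ineq \<Omega> T lam r)"

end

theory Submission
  imports Defs
begin

text \<open>In all cases \<open>C \<le> (\<lambda> - \<parallel>T\<parallel>) / \<lambda>\<close>. If \<open>\<parallel>f\<parallel> \<le> M\<close> on the ball, which contains the polydisc of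
  radius \<open>\<kappa> = n\<^bsup>-1/p\<^esup>\<close> and is contained in the unit polydisc, then Cauchy's estimates give
  \<open>\<kappa>\<^bsup>|\<alpha>|\<^esup> \<parallel>a\<^sub>\<alpha>\<parallel> \<le> M\<close>. For \<open>r = \<kappa> C/n\<close> the Bohr sum is therefore at most
  \<open>\<parallel>T\<parallel> M (1 - C/n)\<^bsup>-n\<^esup>\<close>, which by Bernoulli's inequality is at most
  \<open>\<parallel>T\<parallel> M / (1 - C) \<le> \<lambda> M\<close>. Since the radius is a \<open>GREATEST\<close> element, one also needs that the
  admissible radii form a closed bounded set: the condition on \<open>r\<close> is a family of inequalities
  between finite sums that are continuous in \<open>r\<close>, and \<open>f z = z\<^sub>i x\<close> with \<open>T x \<noteq> 0\<close> bounds \<open>r\<close>.\<close>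

section \<open>Complex scalars and monomials\<close>

lemma scaleC_zero_right [simp]: "c *\<^sub>C (0 :: 'a::complex_normed_vector) = 0"
  using scaleC_add_right[of c 0 "0 :: 'a"] by simp

lemma scaleC_zero_left [simp]: "0 *\<^sub>C (x :: 'a::complex_normed_vector) = 0"
  using scaleC_add_left[of 0 0 x] by simp

lemma scaleC_sum_right:
  "c *\<^sub>C (\<Sum>i\<in>A. g i :: 'a::complex_normed_vector) = (\<Sum>i\<in>A. c *\<^sub>C g i)"
  by (induction A rule: infinite_finite_induct) (auto simp: scaleC_add_right)

lemma scaleC_sum_left:
  "(\<Sum>i\<in>A. g i) *\<^sub>C (x :: 'a::complex_normed_vector) = (\<Sum>i\<in>A. g i *\<^sub>C x)"
  by (induction A rule: infinite_finite_induct) (auto simp: scaleC_add_left)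

lemma monomial_scaleR: "monomial (r *\<^sub>R z) \<alpha> = of_real (r ^ sum \<alpha> UNIV) * monomial z \<alpha>"
  by (simp add: monomial_def power_sum power_mult_distrib prod.distrib scaleR_conv_of_real[where 'a = complex])

lemma norm_monomial_le:
  assumes "\<And>i. cmod (z $ i) \<le> B"
  shows "cmod (monomial z \<alpha>) \<le> B ^ sum \<alpha> UNIV"
  unfolding monomial_def prod_norm[symmetric] power_sum norm_power
  by (intro prod_mono conjI power_mono assms) auto

section \<open>Cauchy's estimate for the coefficients by a discrete Fourier average\<close>

lemma sum_powers_of_root_of_unity:
  fixes q :: complex
  assumes "q ^ N = 1"
  shows "(\<Sum>j<N. q ^ j) = (if q = 1 then of_nat N else 0)"
  using assms by (auto simp: sum_gp_strict)

text \<open>The bound comes from averaging \<open>f\<close> over the points of the torus whose arguments are \<open>N\<close>-th roots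
  of unity: this leaves only the terms with exponent congruent to \<open>\<alpha>\<close> modulo \<open>N\<close>, and for large \<open>N\<close>
  those other than \<open>\<alpha>\<close> itself lie in a tail of the unconditionally convergent series.\<close>

lemma norm_coefficient_le:
  fixes a :: "('n::finite \<Rightarrow> nat) \<Rightarrow> 'x::complex_normed_vector"
  assumes R: "0 \<le> R"
    and series: "\<And>z. (\<And>i. cmod (z $ i) = R) \<Longrightarrow> ((\<lambda>\<alpha>. monomial z \<alpha> *\<^sub>C a \<alpha>) has_sum f z) UNIV"
    and bound: "\<And>z. (\<And>i. cmod (z $ i) = R) \<Longrightarrow> norm (f z) \<le> M"
  shows "R ^ sum \<alpha> UNIV * norm (a \<alpha>) \<le> M"
proof (rule field_le_epsilon)
  fix e :: real
  assume e: "0 < e"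
  define z0 :: "complex ^ 'n" where "z0 = (\<chi> i. of_real R)"
  define g where "g \<beta> = complex_of_real (R ^ sum \<beta> UNIV) *\<^sub>C a \<beta>" for \<beta> :: "'n \<Rightarrow> nat"
  have "((\<lambda>\<alpha>. monomial z0 \<alpha> *\<^sub>C a \<alpha>) has_sum f z0) UNIV"
    by (rule series) (simp add: z0_def R)
  moreover have "monomial z0 \<beta> *\<^sub>C a \<beta> = g \<beta>" for \<beta>
    by (simp add: monomial_def z0_def g_def power_sum)
  ultimately have "(g has_sum f z0) UNIV" by simp
  \<comment> \<open>The tolerance is \<open>e / 4\<close> because a finite sum of \<open>g\<close>
    outside \<open>F\<close> is a difference of two sums over sets containing \<open>F\<close>, each
    that close to \<open>f z0\<close>.\<close>
  then have "\<forall>\<^sub>F G in finite_subsets_at_top UNIV. dist (sum g G) (f z0) < e / 4"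
    unfolding has_sum_def using e by (auto dest!: tendstoD[where e = "e / 4"])
  then obtain F where F: "finite F"
    and F_close: "\<And>G. finite G \<Longrightarrow> F \<subseteq> G \<Longrightarrow> dist (sum g G) (f z0) < e / 4"
    unfolding eventually_finite_subsets_at_top by auto
  have tail: "norm (sum g H) \<le> e / 2" if "finite H" "H \<inter> F = {}" for H
  proof -
    have "sum g H = sum g (H \<union> F) - sum g F"
      using that F by (simp add: sum.union_disjoint)
    also have "norm \<dots> \<le> dist (sum g (H \<union> F)) (f z0) + dist (sum g F) (f z0)"
      unfolding dist_norm[symmetric] by (rule dist_triangle2)
    also have "\<dots> \<le> e / 2"
      using F_close[of "H \<union> F"] F_close[of F] that F by auto
    finally show ?thesis .
  qed

  \<comment> \<open>\<open>N\<close> exceeds every exponent in \<alpha> and in the members of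
    \<open>F\<close>, so among these only \<alpha> is congruent to \<alpha> modulo \<open>N\<close>
    in each coordinate.\<close>
  define N where "N = Suc (\<Sum>\<beta>\<in>insert \<alpha> F. sum \<beta> UNIV)"
  have small: "\<beta> i < N" if "\<beta> \<in> insert \<alpha> F" for \<beta> i
  proof -
    have "\<beta> i \<le> sum \<beta> UNIV" by (rule member_le_sum) auto
    also have "\<dots> \<le> (\<Sum>\<beta>\<in>insert \<alpha> F. sum \<beta> UNIV)"
      by (rule member_le_sum[where f = "\<lambda>\<beta>. sum \<beta> UNIV"]) (use that F in auto)
    finally show ?thesis by (simp add: N_def)
  qed
  have N: "0 < N" by (simp add: N_def)
  define \<omega> where "\<omega> = cis (2 * pi / N)"
  have \<omega>_pow: "\<omega> ^ j = cis (2 * pi * real j / real N)" for j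
    by (simp add: \<omega>_def Complex.DeMoivre mult_ac)
  have \<omega>_N: "\<omega> ^ N = 1" using N by (simp add: \<omega>_pow)
  have norm_\<omega> [simp]: "cmod \<omega> = 1" by (simp add: \<omega>_def)
  have \<omega>_cnj: "\<omega> ^ j * cnj \<omega> ^ j = 1" for j
    by (simp flip: power_mult_distrib add: complex_norm_square[symmetric])
  have \<omega>_inj: "j = k" if "\<omega> ^ j * cnj \<omega> ^ k = 1" "j < N" "k < N" for j k
  proof -
    have "\<omega> ^ j = \<omega> ^ j * cnj \<omega> ^ k * \<omega> ^ k"
      using \<omega>_cnj[of k] by (simp add: mult_ac)
    then have "\<omega> ^ j = \<omega> ^ k" using that by simp
    then show ?thesis
      using Complex.bij_betw_roots_unity[OF N] that
      by (auto simp: bij_betw_def inj_on_def \<omega>_pow)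
  qed

  \<comment> \<open>\<open>K\<close> indexes the grid points \<open>w k\<close> on the torus;
    \<open>c k\<close> is the conjugate of the character value belonging to \<alpha>.\<close>
  define K :: "('n \<Rightarrow> nat) set" where "K = PiE UNIV (\<lambda>_. {..<N})"
  define w :: "('n \<Rightarrow> nat) \<Rightarrow> complex ^ 'n" where "w k = (\<chi> i. of_real R * \<omega> ^ k i)" for k
  define c where "c k = (\<Prod>i\<in>UNIV. cnj \<omega> ^ (\<alpha> i * k i))" for k :: "'n \<Rightarrow> nat"
  have finK: "finite K" by (auto simp: K_def intro: finite_PiE)
  have cardK: "card K = N ^ CARD('n)" by (simp add: K_def card_PiE)
  have norm_w: "cmod (w k $ i) = R" for k i by (simp add: w_def norm_mult norm_power R)
  have norm_c: "cmod (c k) = 1" for k by (simp add: c_def norm_power flip: prod_norm)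

  define q where "q \<beta> i = \<omega> ^ \<beta> i * cnj \<omega> ^ \<alpha> i" for \<beta> i
  \<comment> \<open>As \<omega> has order \<open>N\<close>, this says that \<beta> and \<alpha>
    agree modulo \<open>N\<close> in each coordinate.\<close>
  define P where "P \<beta> \<longleftrightarrow> (\<forall>i. q \<beta> i = 1)" for \<beta>
  have q_N: "q \<beta> i ^ N = 1" for \<beta> i
    using \<omega>_N by (simp add: q_def power_mult_distrib flip: power_mult)
      (simp add: mult.commute[of _ N] power_mult flip: complex_cnj_power)
  have P_\<alpha>: "P \<alpha>" by (simp add: P_def q_def \<omega>_cnj)
  have P_F: "\<beta> = \<alpha>" if "P \<beta>" "\<beta> \<in> F" for \<beta>
    using that \<omega>_inj small by (intro ext) (auto simp: P_def q_def)
  \<comment> \<open>Orthogonality of characters: the sum over the grid factors into one geometric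
    sum per coordinate, equal to \<open>N\<close> or 0.\<close>
  have orth: "(\<Sum>k\<in>K. c k * monomial (w k) \<beta>)
      = (if P \<beta> then of_nat (card K) * of_real (R ^ sum \<beta> UNIV) else 0)" for \<beta>
  proof -
    have "c k * monomial (w k) \<beta> = of_real (R ^ sum \<beta> UNIV) * (\<Prod>i\<in>UNIV. q \<beta> i ^ k i)" for k
      unfolding c_def monomial_def w_def q_def
      by (simp add: power_sum power_mult_distrib prod.distrib mult_ac flip: power_mult)
    then have "(\<Sum>k\<in>K. c k * monomial (w k) \<beta>)
        = of_real (R ^ sum \<beta> UNIV) * (\<Sum>k\<in>K. \<Prod>i\<in>UNIV. q \<beta> i ^ k i)"
      by (simp add: sum_distrib_left)
    also have "(\<Sum>k\<in>K. \<Prod>i\<in>UNIV. q \<beta> i ^ k i) = (\<Prod>i\<in>UNIV. \<Sum>j<N. q \<beta> i ^ j)"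
      unfolding K_def by (rule prod_sum_PiE[symmetric]) auto
    also have "\<dots> = (\<Prod>i\<in>UNIV. if q \<beta> i = 1 then of_nat N else 0)"
      by (simp add: sum_powers_of_root_of_unity q_N)
    also have "\<dots> = (if P \<beta> then of_nat (card K) else 0)"
      using N by (auto simp: P_def cardK)
    finally show ?thesis by simp
  qed

  \<comment> \<open>The grid is finite, so one finite \<open>G\<close> serves all its points at
    once, and it may be enlarged to contain \<alpha>.\<close>
  have "\<forall>\<^sub>F G in finite_subsets_at_top UNIV.
      \<forall>k\<in>K. dist (\<Sum>\<beta>\<in>G. monomial (w k) \<beta> *\<^sub>C a \<beta>) (f (w k)) < e / 2"
    using series[OF norm_w] e finK unfolding has_sum_def
    by (intro eventually_ball_finite ballI tendstoD) auto
  then obtain G0 where "finite G0" and "\<And>G k. finite G \<Longrightarrow> G0 \<subseteq> G \<Longrightarrow> k \<in> K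
      \<Longrightarrow> dist (\<Sum>\<beta>\<in>G. monomial (w k) \<beta> *\<^sub>C a \<beta>) (f (w k)) < e / 2"
    unfolding eventually_finite_subsets_at_top by auto
  then obtain G where G: "finite G" "\<alpha> \<in> G"
    and close: "\<And>k. k \<in> K \<Longrightarrow> dist (\<Sum>\<beta>\<in>G. monomial (w k) \<beta> *\<^sub>C a \<beta>) (f (w k)) < e / 2"
    by (metis finite_insert insertI1 subset_insertI)
  define H where "H = {\<beta> \<in> G. P \<beta>} - {\<alpha>}"

  \<comment> \<open>Averaging the truncated series against the unimodular \<open>c k\<close>
    isolates the indices satisfying \<open>P\<close>; the truncation adds at most
    \<open>e / 2\<close> to \<open>M\<close>.\<close>
  have "of_nat (card K) *\<^sub>C (\<Sum>\<beta> | \<beta> \<in> G \<and> P \<beta>. g \<beta>)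
      = (\<Sum>\<beta>\<in>G. (\<Sum>k\<in>K. c k * monomial (w k) \<beta>) *\<^sub>C a \<beta>)"
    unfolding sum.inter_filter[OF G(1)] scaleC_sum_right orth
    by (intro sum.cong) (auto simp: g_def scaleC_scaleC)
  also have "\<dots> = (\<Sum>k\<in>K. c k *\<^sub>C (\<Sum>\<beta>\<in>G. monomial (w k) \<beta> *\<^sub>C a \<beta>))"
    by (simp add: scaleC_sum_left scaleC_sum_right scaleC_scaleC sum.swap[of _ G])
  also have "norm \<dots> \<le> (\<Sum>k\<in>K. M + e / 2)"
  proof (rule sum_norm_le)
    fix k assume "k \<in> K"
    from close[OF this] bound[OF norm_w, of k]
    show "norm (c k *\<^sub>C (\<Sum>\<beta>\<in>G. monomial (w k) \<beta> *\<^sub>C a \<beta>)) \<le> M + e / 2"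
      unfolding norm_scaleC norm_c dist_norm by norm
  qed
  finally have "real (card K) * norm (\<Sum>\<beta> | \<beta> \<in> G \<and> P \<beta>. g \<beta>) \<le> real (card K) * (M + e / 2)"
    by (simp add: norm_scaleC)
  then have avg: "norm (\<Sum>\<beta> | \<beta> \<in> G \<and> P \<beta>. g \<beta>) \<le> M + e / 2"
    using N by (simp add: cardK)
  have "(\<Sum>\<beta> | \<beta> \<in> G \<and> P \<beta>. g \<beta>) = g \<alpha> + sum g H"
    unfolding H_def by (rule sum.remove) (use G P_\<alpha> in auto)
  \<comment> \<open>\<open>H\<close> misses \<open>F\<close>: within \<open>F\<close>, only \<alpha>
    can satisfy \<open>P\<close>, and \<alpha> was removed from \<open>H\<close>.\<close>
  moreover have "norm (sum g H) \<le> e / 2"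
    by (rule tail) (use G P_F in \<open>auto simp: H_def\<close>)
  ultimately have "norm (g \<alpha>) \<le> M + e"
    using avg norm_triangle_ineq4[of "g \<alpha> + sum g H" "sum g H"] by simp
  then show "R ^ sum \<alpha> UNIV * norm (a \<alpha>) \<le> M + e"
    using R by (simp add: g_def norm_scaleC norm_power)
qed

section \<open>The admissible radii as a closed and bounded set\<close>

text \<open>Real values turn the terms of the Bohr series into real monomials in the radius. On a
  bounded \<Omega> the supremum is finite, so \<open>enn2real\<close> loses nothing.\<close>

definition monomial_sup :: "(complex ^ 'n::finite) set \<Rightarrow> ('n \<Rightarrow> nat) \<Rightarrow> real" where
  "monomial_sup \<Omega> \<alpha> = enn2real (SUP z\<in>\<Omega>. ennreal (cmod (monomial z \<alpha>)))"

lemma monomial_sup_nonneg [simp]: "0 \<le> monomial_sup \<Omega> \<alpha>"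
  by (simp add: monomial_sup_def)

lemma monomial_sup_le_1:
  assumes "\<And>z i. z \<in> \<Omega> \<Longrightarrow> cmod (z $ i) \<le> 1"
  shows "monomial_sup \<Omega> \<alpha> \<le> 1"
  unfolding monomial_sup_def
proof (rule enn2real_leI)
  show "(SUP z\<in>\<Omega>. ennreal (cmod (monomial z \<alpha>))) \<le> ennreal 1"
    using norm_monomial_le[where B = 1, of _ \<alpha>] assms by (auto intro!: SUP_least simp del: ennreal_1)
qed simp

text \<open>By homogeneity the scaling contributes the factor \<open>r ^ sum \<alpha> UNIV\<close>,
  which can be taken out of the supremum.\<close>

lemma SUP_scaled_monomial:
  fixes x :: "'x::complex_normed_vector"
  assumes "bounded \<Omega>" and r: "0 \<le> r"
  shows "(SUP z\<in>(\<lambda>z. r *\<^sub>R z) ` \<Omega>. ennreal (norm (monomial z \<alpha> *\<^sub>C x)))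
    = ennreal (r ^ sum \<alpha> UNIV * (monomial_sup \<Omega> \<alpha> * norm x))"
proof -
  from \<open>bounded \<Omega>\<close> obtain B where B: "\<And>z. z \<in> \<Omega> \<Longrightarrow> norm z \<le> B"
    by (auto simp: bounded_iff)
  have "(SUP z\<in>\<Omega>. ennreal (cmod (monomial z \<alpha>))) \<le> ennreal (B ^ sum \<alpha> UNIV)"
    by (intro SUP_least ennreal_leI norm_monomial_le order_trans[OF Finite_Cartesian_Product.norm_nth_le] B)
  then have fin: "(SUP z\<in>\<Omega>. ennreal (cmod (monomial z \<alpha>))) = ennreal (monomial_sup \<Omega> \<alpha>)"
    unfolding monomial_sup_def
    by (intro ennreal_enn2real[symmetric] le_less_trans[OF _ ennreal_less_top])
  have scaled: "ennreal (norm (monomial (r *\<^sub>R z) \<alpha> *\<^sub>C x))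
      = ennreal (r ^ sum \<alpha> UNIV * norm x) * ennreal (cmod (monomial z \<alpha>))" for z
    using r by (simp add: monomial_scaleR norm_scaleC norm_mult norm_power mult_ac flip: ennreal_mult)
  show ?thesis
    unfolding image_image scaled SUP_mult_left_ennreal[symmetric] fin
    using r by (simp add: mult_ac flip: ennreal_mult)
qed

text \<open>In [0, \<infinity>] a series is the supremum of its finite partial sums. What remains
  are conditions polynomial in \<open>r\<close>, each of them closed.\<close>

lemma second_bohr_ineq_iff:
  assumes "bounded \<Omega>" "0 \<le> r"
  shows "second_bohr_ineq \<Omega> T lam r \<longleftrightarrow>
    (\<forall>f a F. holomorphic_vec_on f \<Omega> \<longrightarrow> has_power_series_on f a \<Omega> \<longrightarrow> finite F \<longrightarrow>
      ennreal (\<Sum>\<alpha>\<in>F. r ^ sum \<alpha> UNIV * (monomial_sup \<Omega> \<alpha> * norm (T (a \<alpha>))))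
        \<le> ennreal lam * (SUP z\<in>\<Omega>. ennreal (norm (f z))))"
  unfolding second_bohr_ineq_def SUP_scaled_monomial[OF assms]
  using assms(2) by (subst nonneg_infsum_complete) (auto simp: SUP_le_iff)

text \<open>\<open>GREATEST\<close> yields a maximum only if one exists. The given \<open>r\<close>
  makes the set of admissible radii nonempty; being closed and bounded above, it contains its
  supremum.\<close>

lemma second_bohr_radius_ge:
  assumes \<Omega>: "bounded \<Omega>"
    and bdd: "\<And>r. 0 \<le> r \<Longrightarrow> second_bohr_ineq \<Omega> T lam r \<Longrightarrow> r \<le> B"
    and r: "0 \<le> r" "second_bohr_ineq \<Omega> T lam r"
  shows "r \<le> second_bohr_radius \<Omega> T lam"
proof -
  define S where "S = {r. 0 \<le> r \<and> second_bohr_ineq \<Omega> T lam r}"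
  have "S = {0..} \<inter> (\<Inter>f. \<Inter>a. \<Inter>F. {r. holomorphic_vec_on f \<Omega> \<longrightarrow> has_power_series_on f a \<Omega> \<longrightarrow> finite F \<longrightarrow>
      ennreal (\<Sum>\<alpha>\<in>F. r ^ sum \<alpha> UNIV * (monomial_sup \<Omega> \<alpha> * norm (T (a \<alpha>))))
        \<le> ennreal lam * (SUP z\<in>\<Omega>. ennreal (norm (f z)))})"
    using second_bohr_ineq_iff[OF \<Omega>] unfolding S_def by fastforce
  \<comment> \<open>The premises do not involve \<open>r\<close>, so they are trivially open
    conditions; the conclusion compares a continuous function of \<open>r\<close> with a
    constant.\<close>
  also have "closed \<dots>"
    by (intro closed_Int closed_INT ballI closed_Collect_imp open_Collect_const closed_Collect_le
        continuous_on_ennreal continuous_intros closed_atLeast)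
  finally have closed: "closed S" .
  have bdd': "bdd_above S" using bdd by (auto simp: S_def intro!: bdd_aboveI[of _ B])
  have "Sup S \<in> S"
    using closed_contains_Sup[OF _ bdd' closed] r by (auto simp: S_def)
  moreover have le: "s \<le> Sup S" if "s \<in> S" for s
    using cSup_upper[OF that bdd'] .
  ultimately have "second_bohr_radius \<Omega> T lam = Sup S"
    unfolding second_bohr_radius_def by (intro Greatest_equality) (auto simp: S_def)
  then show ?thesis using le r by (simp add: S_def)
qed

text \<open>For the test function \<open>(z $ i) *\<^sub>C x\<close> the one nonzero coefficient
  contributes at least \<open>r * (cmod (u $ i) * norm (T x))\<close>, while the right-hand side is
  at most \<open>lam * norm x\<close>.\<close>

lemma second_bohr_ineq_imp_le:
  fixes \<Omega> :: "(complex ^ 'n::finite) set" and T :: "'x::complex_banach \<Rightarrow> 'y::complex_banach"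
  assumes coord: "\<And>z. z \<in> \<Omega> \<Longrightarrow> cmod (z $ i) \<le> 1"
    and u: "u \<in> \<Omega>" "u $ i \<noteq> 0"
    and T: "T 0 = 0" "T x \<noteq> 0"
    and "0 \<le> r" "0 < lam" and ineq: "second_bohr_ineq \<Omega> T lam r"
  shows "r \<le> lam * norm x / (cmod (u $ i) * norm (T x))"
proof -
  define f where "f z = (z $ i) *\<^sub>C x" for z :: "complex ^ 'n"
  define \<delta> :: "'n \<Rightarrow> nat" where "\<delta> j = (if j = i then 1 else 0)" for j
  define a where "a \<alpha> = (if \<alpha> = \<delta> then x else 0)" for \<alpha>
  have mon: "monomial z \<delta> = z $ i" for z :: "complex ^ 'n"
    by (simp add: monomial_def \<delta>_def if_distrib[where f = "\<lambda>k. _ ^ k"] cong: if_cong)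
  have "bounded_linear f"
  proof (rule bounded_linear_intro[where K = "norm x"])
    show "norm (f z) \<le> norm z * norm x" for z
      by (simp add: f_def norm_scaleC mult_right_mono Finite_Cartesian_Product.norm_nth_le)
    show "f (r *\<^sub>R z) = r *\<^sub>R f z" for r z
      by (simp add: f_def scaleC_scaleC scaleR_conv_of_real[where 'a = complex] flip: scaleC_complex_of_real)
  qed (simp add: f_def scaleC_add_left)
  then have hol: "holomorphic_vec_on f \<Omega>"
    unfolding holomorphic_vec_on_def
    by (intro ballI exI[of _ f] conjI bounded_linear_imp_has_derivative)
      (auto simp: f_def scaleC_scaleC)
  have ps: "has_power_series_on f a \<Omega>"
    unfolding has_power_series_on_def
    by (intro ballI has_sum_finite_neutralI[where B = "{\<delta>}"]) (auto simp: a_def f_def mon)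
  let ?t = "\<lambda>\<alpha>. SUP z\<in>(\<lambda>z. r *\<^sub>R z) ` \<Omega>. ennreal (norm (monomial z \<alpha> *\<^sub>C T (a \<alpha>)))"
  have "ennreal (r * (cmod (u $ i) * norm (T x))) \<le> ?t \<delta>"
    by (rule SUP_upper2[of "r *\<^sub>R u"])
      (use u \<open>0 \<le> r\<close> in \<open>auto simp: mon a_def norm_scaleC mult_ac\<close>)
  also have "\<dots> \<le> infsum ?t UNIV"
    by (subst nonneg_infsum_complete) (auto intro!: SUP_upper2[of "{\<delta>}"])
  also have "\<dots> \<le> ennreal lam * (SUP z\<in>\<Omega>. ennreal (norm (f z)))"
    using ineq hol ps by (auto simp: second_bohr_ineq_def)
  also have "\<dots> \<le> ennreal lam * ennreal (norm x)"
    by (intro mult_left_mono SUP_least ennreal_leI)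
      (auto simp: f_def norm_scaleC intro!: mult_left_le_one_le coord)
  finally have "r * (cmod (u $ i) * norm (T x)) \<le> lam * norm x"
    using \<open>0 < lam\<close> by (simp flip: ennreal_mult)
  then show ?thesis
    using u T by (simp add: field_simps)
qed

section \<open>The Bohr inequality on a set between two polydiscs\<close>

text \<open>Over a box containing \<open>F\<close> the sum is a product of finite geometric sums,
  one per coordinate, each at most \<open>1 / (1 - s)\<close>.\<close>

lemma sum_power_multiindex_le:
  fixes F :: "('n::finite \<Rightarrow> nat) set"
  assumes "finite F" and s: "0 \<le> s" "s < (1 :: real)"
  shows "(\<Sum>\<alpha>\<in>F. s ^ sum \<alpha> UNIV) \<le> (1 / (1 - s)) ^ CARD('n)"
proof -
  define N where "N = Suc (\<Sum>\<beta>\<in>F. sum \<beta> UNIV)"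
  have "\<beta> i < N" if "\<beta> \<in> F" for \<beta> i
  proof -
    have "\<beta> i \<le> sum \<beta> UNIV" by (rule member_le_sum) auto
    also have "\<dots> \<le> (\<Sum>\<beta>\<in>F. sum \<beta> UNIV)"
      by (rule member_le_sum[where f = "\<lambda>\<beta>. sum \<beta> UNIV"]) (use that assms in auto)
    finally show ?thesis by (simp add: N_def)
  qed
  then have "(\<Sum>\<alpha>\<in>F. s ^ sum \<alpha> UNIV) \<le> (\<Sum>\<alpha>\<in>PiE (UNIV :: 'n set) (\<lambda>_. {..<N}). s ^ sum \<alpha> UNIV)"
    using s by (intro sum_mono2 finite_PiE) (auto simp: PiE_iff)
  also have "\<dots> = (\<Prod>i\<in>(UNIV :: 'n set). \<Sum>j<N. s ^ j)"
    unfolding power_sum by (rule prod_sum_PiE[symmetric]) auto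
  also have "\<dots> \<le> (\<Prod>i\<in>(UNIV :: 'n set). 1 / (1 - s))"
    using s by (intro prod_mono conjI sum_nonneg) (auto simp: sum_gp_strict divide_simps)
  finally show ?thesis by simp
qed

text \<open>The tori of radius below \<kappa> inside \<Omega> bound the coefficients; the closed
  unit polydisc around \<Omega> bounds the monomials by 1.\<close>

lemma second_bohr_ineq_of_polydisc:
  fixes \<Omega> :: "(complex ^ 'n::finite) set" and T :: "'x::complex_banach \<Rightarrow> 'y::complex_banach"
  assumes \<Omega>: "\<And>z i. z \<in> \<Omega> \<Longrightarrow> cmod (z $ i) \<le> 1" "bounded \<Omega>"
    and polydisc: "\<And>z R. 0 \<le> R \<Longrightarrow> R < \<kappa> \<Longrightarrow> (\<And>i. cmod (z $ i) = R) \<Longrightarrow> z \<in> \<Omega>"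
    and \<kappa>: "0 < \<kappa>"
    and T: "bounded_linear T" and lam: "0 < lam"
    and C: "0 \<le> C" "C < 1" "onorm T \<le> lam * (1 - C)"
  shows "second_bohr_ineq \<Omega> T lam (C / real CARD('n) * \<kappa>)"
proof (subst second_bohr_ineq_iff[OF \<Omega>(2)])
  show "0 \<le> C / real CARD('n) * \<kappa>" using C \<kappa> by simp
  show "\<forall>f a F. holomorphic_vec_on f \<Omega> \<longrightarrow> has_power_series_on f a \<Omega> \<longrightarrow> finite F \<longrightarrow>
      ennreal (\<Sum>\<alpha>\<in>F. (C / real CARD('n) * \<kappa>) ^ sum \<alpha> UNIV * (monomial_sup \<Omega> \<alpha> * norm (T (a \<alpha>))))
        \<le> ennreal lam * (SUP z\<in>\<Omega>. ennreal (norm (f z)))"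
  proof (intro allI impI)
    fix f :: "complex ^ 'n \<Rightarrow> 'x" and a and F :: "('n \<Rightarrow> nat) set"
    assume ps: "has_power_series_on f a \<Omega>" and F: "finite F"
    \<comment> \<open>With the radius written as \<open>s * \<kappa>\<close>, the powers of \<kappa>
      are absorbed by Cauchy's estimate and a geometric series in \<open>s\<close> is left.\<close>
    define s where "s = C / real CARD('n)"
    have s: "0 \<le> s" "s < 1" using C by (auto simp: s_def field_simps intro: less_le_trans)
    show "ennreal (\<Sum>\<alpha>\<in>F. (C / real CARD('n) * \<kappa>) ^ sum \<alpha> UNIV * (monomial_sup \<Omega> \<alpha> * norm (T (a \<alpha>))))
        \<le> ennreal lam * (SUP z\<in>\<Omega>. ennreal (norm (f z)))"
    proof (cases "(SUP z\<in>\<Omega>. ennreal (norm (f z))) = top")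
      case True
      \<comment> \<open>The right-hand side is infinite because \<open>lam\<close> is
        positive.\<close>
      show ?thesis unfolding True using lam by (simp add: ennreal_mult_top)
    next
      case False
      then obtain M where M: "0 \<le> M" "(SUP z\<in>\<Omega>. ennreal (norm (f z))) = ennreal M"
        by (metis ennreal_cases)
      have f_le: "norm (f z) \<le> M" if "z \<in> \<Omega>" for z
      proof -
        have "ennreal (norm (f z)) \<le> ennreal M"
          unfolding M(2)[symmetric] by (rule SUP_upper[OF that])
        then show ?thesis using M by simp
      qed
      \<comment> \<open>The torus of radius \<kappa> itself need not lie in \<Omega>, so the
        estimate is the limit of those for smaller radii.\<close>
      have coeff: "\<kappa> ^ sum \<alpha> UNIV * norm (a \<alpha>) \<le> M" for \<alpha>
      proof (rule tendsto_upperbound)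
        show "((\<lambda>R. R ^ sum \<alpha> UNIV * norm (a \<alpha>)) \<longlongrightarrow> \<kappa> ^ sum \<alpha> UNIV * norm (a \<alpha>)) (at_left \<kappa>)"
          by (intro tendsto_intros)
        have "\<forall>\<^sub>F R in at_left \<kappa>. R \<in> {0<..<\<kappa>}"
          by (rule eventually_at_left_real[OF \<kappa>])
        then show "\<forall>\<^sub>F R in at_left \<kappa>. R ^ sum \<alpha> UNIV * norm (a \<alpha>) \<le> M"
        proof eventually_elim
          case (elim R)
          then have in_\<Omega>: "z \<in> \<Omega>" if "\<And>i. cmod (z $ i) = R" for z
            using polydisc[of R z] that by simp
          show ?case
            by (rule norm_coefficient_le[where f = f])
              (use ps elim in_\<Omega> f_le in \<open>auto simp: has_power_series_on_def\<close>)
        qed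
      qed simp
      have "(\<Sum>\<alpha>\<in>F. (s * \<kappa>) ^ sum \<alpha> UNIV * (monomial_sup \<Omega> \<alpha> * norm (T (a \<alpha>))))
          \<le> (\<Sum>\<alpha>\<in>F. onorm T * M * s ^ sum \<alpha> UNIV)"
      proof (rule sum_mono)
        fix \<alpha>
        have "monomial_sup \<Omega> \<alpha> * norm (T (a \<alpha>)) \<le> 1 * (onorm T * norm (a \<alpha>))"
          by (intro mult_mono monomial_sup_le_1 \<Omega> onorm T) auto
        then have "(s * \<kappa>) ^ sum \<alpha> UNIV * (monomial_sup \<Omega> \<alpha> * norm (T (a \<alpha>)))
            \<le> (s * \<kappa>) ^ sum \<alpha> UNIV * (onorm T * norm (a \<alpha>))"
          using s \<kappa> by (intro mult_left_mono) auto
        also have "\<dots> = onorm T * s ^ sum \<alpha> UNIV * (\<kappa> ^ sum \<alpha> UNIV * norm (a \<alpha>))"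
          by (simp add: power_mult_distrib mult_ac)
        also have "\<dots> \<le> onorm T * s ^ sum \<alpha> UNIV * M"
          using s onorm_pos_le[OF T] by (intro mult_left_mono coeff) auto
        finally show "(s * \<kappa>) ^ sum \<alpha> UNIV * (monomial_sup \<Omega> \<alpha> * norm (T (a \<alpha>)))
            \<le> onorm T * M * s ^ sum \<alpha> UNIV" by (simp add: mult_ac)
      qed
      also have "\<dots> \<le> onorm T * M * (1 / (1 - s)) ^ CARD('n)"
        unfolding sum_distrib_left[symmetric] using M onorm_pos_le[OF T]
        by (intro mult_left_mono sum_power_multiindex_le F s) auto
      also have "\<dots> \<le> onorm T * M * (1 / (1 - C))"
      proof (intro mult_left_mono)
        \<comment> \<open>This is why \<open>s\<close> is \<open>C\<close> divided by the dimension
          n: Bernoulli's bound 1 - n s is then exactly \<open>1 - C\<close>.\<close>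
        have "1 - C \<le> (1 - s) ^ CARD('n)"
          using Bernoulli_inequality[of "- s" "CARD('n)"] s by (simp add: s_def)
        then show "(1 / (1 - s)) ^ CARD('n) \<le> 1 / (1 - C)"
          using C s by (simp add: power_divide frac_le)
      qed (use M onorm_pos_le[OF T] in auto)
      also have "\<dots> \<le> lam * M"
        using mult_right_mono[OF C(3) M(1)] C by (simp add: field_simps)
      finally show ?thesis
        using M lam by (simp add: s_def flip: ennreal_mult)
    qed
  qed
qed

section \<open>The balls of the l_p norms and the lower bound for their Bohr radius\<close>

lemma ereal_ge_1_cases:
  assumes "1 \<le> (p :: ereal)"
  obtains "p = \<infinity>" | q where "p = ereal q" "1 \<le> q"
  using assms by (cases p) auto

lemma lp_ball_coord_less_1:
  assumes p: "1 \<le> p" and z: "z \<in> lp_ball p"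
  shows "cmod (z $ i) < 1"
  using p
proof (cases rule: ereal_ge_1_cases)
  case 1
  have "cmod (z $ i) \<le> Max (range (\<lambda>i. cmod (z $ i)))" by (intro Max_ge) auto
  then show ?thesis using 1 z by (simp add: lp_ball_def lp_norm_def)
next
  case (2 q)
  have "cmod (z $ i) = (cmod (z $ i) powr q) powr (1 / q)"
    using 2 by (simp add: powr_powr)
  also have "\<dots> \<le> (\<Sum>i\<in>UNIV. cmod (z $ i) powr q) powr (1 / q)"
    using 2 by (intro powr_mono2 member_le_sum[where f = "\<lambda>i. cmod (z $ i) powr q"]) auto
  also have "\<dots> < 1" using 2 z by (simp add: lp_ball_def lp_norm_def)
  finally show ?thesis .
qed

lemma bounded_lp_ball:
  assumes "1 \<le> p"
  shows "bounded (lp_ball p :: (complex ^ 'n::finite) set)"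
  unfolding bounded_iff
proof (intro exI ballI)
  fix z :: "complex ^ 'n" assume z: "z \<in> lp_ball p"
  have "norm z \<le> (\<Sum>i\<in>UNIV. cmod (z $ i))" 
    unfolding norm_vec_def by (rule L2_set_le_sum) simp
  also have "\<dots> \<le> (\<Sum>i\<in>(UNIV :: 'n set). 1)"
    using lp_ball_coord_less_1[OF assms z] by (intro sum_mono) (simp add: less_imp_le)
  finally show "norm z \<le> real CARD('n)" by simp
qed

text \<open>If all n coordinates have modulus \<open>R\<close>, the norm is n^(1/p)
  \<open>R\<close>; for p = \<infinity> the exponent is 0.\<close>

lemma mem_lp_ball_of_coords_eq:
  fixes z :: "complex ^ 'n::finite"
  assumes p: "1 \<le> p" and R: "0 \<le> R" "R < real CARD('n) powr - real_of_ereal (1 / p)"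
    and z: "\<And>i. cmod (z $ i) = R"
  shows "z \<in> lp_ball p"
  using p
proof (cases rule: ereal_ge_1_cases)
  case 1
  then show ?thesis using R z by (simp add: lp_ball_def lp_norm_def)
next
  case (2 q)
  have "1 / p = ereal (1 / q)" using 2 by (simp add: one_ereal_def)
  then have "R < real CARD('n) powr - (1 / q)" using R by simp
  then have "R * real CARD('n) powr (1 / q) < 1"
    by (simp add: powr_minus field_simps)
  moreover have "lp_norm p z = real CARD('n) powr (1 / q) * R"
    using 2 R z by (simp add: lp_norm_def powr_mult powr_powr)
  ultimately show ?thesis by (simp add: lp_ball_def mult.commute)
qed

theorem theorem2p8:
  fixes T :: "'x::complex_banach \<Rightarrow> 'y::complex_banach"
    and lam :: real
    and p :: ereal
  assumes "bounded_clinear T"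
    and "T \<noteq> (\<lambda>x. 0)"
    and "onorm T \<le> lam"
    and "1 \<le> p"
  shows
    "let \<rho> = (lam - onorm T) / (2 * lam - onorm T);
         \<sigma>1 = (lam - onorm T) / ((lam - onorm T + 1) * onorm T);
         \<sigma>2 = (lam - onorm T) / (lam - onorm T + 1);
         C = (if onorm T \<ge> 1 then max \<rho> \<sigma>1 else max \<rho> \<sigma>2)
     in second_bohr_radius (lp_ball p :: (complex ^ 'n::finite) set) T lam
          \<ge> C / real CARD('n) powr (1 + real_of_ereal (1 / p))"
proof -
  let ?\<tau> = "onorm T" and ?\<Omega> = "lp_ball p :: (complex ^ 'n) set" and ?n = "real CARD('n)"
  define C where "C = (if ?\<tau> \<ge> 1
      then max ((lam - ?\<tau>) / (2 * lam - ?\<tau>)) ((lam - ?\<tau>) / ((lam - ?\<tau> + 1) * ?\<tau>))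
      else max ((lam - ?\<tau>) / (2 * lam - ?\<tau>)) ((lam - ?\<tau>) / (lam - ?\<tau> + 1)))"
  define \<kappa> where "\<kappa> = ?n powr - real_of_ereal (1 / p)"
  have \<kappa>: "0 < \<kappa>" by (simp add: \<kappa>_def)
  have T: "bounded_linear T" using assms(1) by (simp add: bounded_clinear_def)
  have \<tau>: "0 < ?\<tau>" using onorm_pos_lt[OF T] assms(2) by (auto simp: fun_eq_iff)
  then have lam: "0 < lam" using assms(3) by simp
  have \<tau>2: "lam - ?\<tau> \<le> (lam - ?\<tau>) * ?\<tau>" if "1 \<le> ?\<tau>"
    using mult_left_mono[OF that, of "lam - ?\<tau>"] assms(3) by simp
  have "0 \<le> C"
    using \<tau> assms(3) by (auto simp: C_def le_max_iff_disj)
  \<comment> \<open>All three fractions share the numerator and have denominators at least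
    \<open>lam\<close>: the first since \<open>onorm T\<close> \<le> \<open>lam\<close>, the second
    by \<open>\<tau>2\<close>, the third since there \<open>onorm T\<close> < 1.\<close>
  moreover have C_le: "C \<le> (lam - ?\<tau>) / lam"
    using \<tau> lam assms(3) \<tau>2 unfolding C_def
    by (auto intro!: divide_left_mono mult_pos_pos simp: algebra_simps)
  moreover have "(lam - ?\<tau>) / lam < 1" using \<tau> lam by simp
  moreover have "?\<tau> \<le> lam * (1 - C)"
    using C_le lam by (simp add: field_simps)
  ultimately have C: "0 \<le> C" "C < 1" "?\<tau> \<le> lam * (1 - C)" by linarith+
  have coord: "cmod (z $ i) \<le> 1" if "z \<in> ?\<Omega>" for z i
    using lp_ball_coord_less_1[OF assms(4) that] by (rule less_imp_le)
  have ineq: "second_bohr_ineq ?\<Omega> T lam (C / ?n * \<kappa>)"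
    by (rule second_bohr_ineq_of_polydisc[OF coord bounded_lp_ball _ \<kappa> T lam C])
      (auto simp: \<kappa>_def intro: mem_lp_ball_of_coords_eq assms(4))
  obtain x where x: "T x \<noteq> 0" using assms(2) by auto
  \<comment> \<open>Half of \<kappa> keeps this vector in the open ball with nonzero coordinates, so
    any coordinate bounds the admissible radii.\<close>
  define u :: "complex ^ 'n" where "u = (\<chi> i. of_real (\<kappa> / 2))"
  have u: "u \<in> ?\<Omega>" "u $ i \<noteq> 0" for i
    using \<kappa> by (auto simp: u_def \<kappa>_def intro!: mem_lp_ball_of_coords_eq[where R = "\<kappa> / 2"] assms(4))
  have T0: "T 0 = 0" using T by (simp add: linear_simps)
  have "C / ?n * \<kappa> \<le> second_bohr_radius ?\<Omega> T lam"
    using second_bohr_ineq_imp_le[OF coord u T0 x _ lam] ineq C \<kappa>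
    by (intro second_bohr_radius_ge[OF bounded_lp_ball[OF assms(4)]]) auto
  moreover have "C / ?n * \<kappa> = C / ?n powr (1 + real_of_ereal (1 / p))"
    by (simp add: \<kappa>_def powr_add powr_minus field_simps)
  ultimately show ?thesis by (simp add: Let_def C_def)
qed

end
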